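(* Let $G$ be a finite simple graph with $n\ge 3$ vertices and $m$ edges. For each integer $i$ let $n_i$ be the number of vertices of degree $i$, and let $\delta$ and $\Delta$ be the minimum and maximum vertex degree, with $\delta\ne\Delta$. Let $\alpha\in\mathbb{R}$, $\alpha\notin\{0,1\}$; when $\alpha<0$ assume $\delta\ge 1$. Put $s_\alpha=\frac{\Delta^\alpha-\delta^\alpha}{\Delta-\delta}$ (and similarly $s_{\alpha+1}=\frac{\Delta^{\alpha+1}-\delta^{\alpha+1}}{\Delta-\delta}$). Then: (1) $M_1^\alpha(G)=n\delta^\alpha+(2m-n\delta)s_\alpha+\sum_{i=1}^{\Delta-\delta-1}n_{\delta+i}\big[(\delta+i)^\alpha-\delta^\alpha-i s_\alpha\big]$. Moreover, if $\alpha<0$ or $\alpha>1$, each coefficient $(\delta+i)^\alpha-\delta^\alpha-is_\alpha\le 0$ for $1\le i\le\Delta-\delta-1$, and if $0<\alpha<1$, each such coefficient is $\ge 0$. (2) $M_1^\alpha(G)=n\delta^\alpha+(2m-n\delta)\big((\delta+1)^\alpha-\delta^\alpha\big)+\sum_{i=2}^{\Delta-\delta}n_{\delta+i}\big[(\delta+i)^\alpha-\delta^\alpha-i((\delta+1)^\alpha-\delta^\alpha)\big]$. Moreover, if $\alpha<0$ or $\alpha>1$, each coefficient $(\delta+i)^\alpha-\delta^\alpha-i((\delta+1)^\alpha-\delta^\alpha)\ge 0$ for $2\le i\le\Delta-\delta$, and if $0<\alpha<1$, each such coefficient is $\le 0$. (3) If $\alpha>1$, then $\overline{M}_1^{\alpha}(G)=n(n-1)\delta^\alpha+(2m-n\delta)s_\alpha(n-1)+(n-1)\sum_{i=1}^{\Delta-\delta-1}n_{\delta+i}\big[(\delta+i)^\alpha-\delta^\alpha-is_\alpha\big]-n\delta^{\alpha+1}-(2m-n\delta)s_{\alpha+1}-\sum_{i=1}^{\Delta-\delta-1}n_{\delta+i}\big[(\delta+i)^{\alpha+1}-\delta^{\alpha+1}-is_{\alpha+1}\big]$.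 (4) If $\alpha>1$, then $\overline{M}_1^{\alpha}(G)=(n-1)n\delta^\alpha+(n-1)(2m-n\delta)\big((\delta+1)^\alpha-\delta^\alpha\big)+(n-1)\sum_{i=2}^{\Delta-\delta}n_{\delta+i}\big[(\delta+i)^\alpha-\delta^\alpha-i((\delta+1)^\alpha-\delta^\alpha)\big]-n\delta^{\alpha+1}-(2m-n\delta)\big((\delta+1)^{\alpha+1}-\delta^{\alpha+1}\big)-\sum_{i=2}^{\Delta-\delta}n_{\delta+i}\big[(\delta+i)^{\alpha+1}-\delta^{\alpha+1}-i((\delta+1)^{\alpha+1}-\delta^{\alpha+1})\big]$.
   Context: For a graph $G$ with vertex set $V(G)$, edge set $E(G)$ and vertex degrees $d(u)$, the general first Zagreb index is $M_1^\alpha(G)=\sum_{u\in V(G)}d(u)^\alpha$, and the general first Zagreb coindex is $\overline{M}_1^{\alpha}(G)=\sum (d(u)^\alpha+d(v)^\alpha)$, the sum taken over all unordered pairs $\{u,v\}$ of distinct vertices with $uv\notin E(G)$. *)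

theory Defs
  imports Complex_Main
begin

text \<open>A finite simple graph is given by its vertex set and its set of edges, each edge being an
  unordered pair of distinct vertices.\<close>

definition vertex_pairs :: "'a set \<Rightarrow> 'a set set" where
  "vertex_pairs V = {{u, v} | u v. u \<in> V \<and> v \<in> V \<and> u \<noteq> v}"

definition finite_simple_graph :: "'a set \<Rightarrow> 'a set set \<Rightarrow> bool" where
  "finite_simple_graph V E \<longleftrightarrow> finite V \<and> E \<subseteq> vertex_pairs V"

definition deg :: "'a set set \<Rightarrow> 'a \<Rightarrow> nat" where
  "deg E u = card {e \<in> E. u \<in> e}"

definition min_deg :: "'a set \<Rightarrow> 'a set set \<Rightarrow> nat" where
  "min_deg V E = Min (deg E ` V)"

definition max_deg :: "'a set \<Rightarrow> 'a set set \<Rightarrow> nat" where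
  "max_deg V E = Max (deg E ` V)"

definition num_deg :: "'a set \<Rightarrow> 'a set set \<Rightarrow> nat \<Rightarrow> nat" where
  "num_deg V E i = card {u \<in> V. deg E u = i}"

text \<open>In Isabelle, \<open>0 powr \<alpha> = 0\<close> for every \<open>\<alpha>\<close>.  This is the usual value for \<open>\<alpha> > 0\<close>; for
  \<open>\<alpha> \<le> 0\<close> the two indices below have their intended meaning only when there are no isolated
  vertices.\<close>

definition zagreb :: "real \<Rightarrow> 'a set \<Rightarrow> 'a set set \<Rightarrow> real" where
  "zagreb \<alpha> V E = (\<Sum>u\<in>V. real (deg E u) powr \<alpha>)"

text \<open>For a non-edge \<open>e = {u, v}\<close> with \<open>u \<noteq> v\<close>, the inner sum is
  \<open>d(u) powr \<alpha> + d(v) powr \<alpha>\<close>.\<close>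

definition zagreb_co :: "real \<Rightarrow> 'a set \<Rightarrow> 'a set set \<Rightarrow> real" where
  "zagreb_co \<alpha> V E = (\<Sum>e \<in> vertex_pairs V - E. \<Sum>w\<in>e. real (deg E w) powr \<alpha>)"

definition chord_slope :: "nat \<Rightarrow> nat \<Rightarrow> real \<Rightarrow> real" where
  "chord_slope a b \<alpha> = (real b powr \<alpha> - real a powr \<alpha>) / (real b - real a)"

end

theory Submission
  imports Defs
begin

text \<open>Fix a slope \<open>t\<close> and write \<open>f d = f \<delta> + (d - \<delta>) t + r d\<close> for each degree \<open>d\<close>.  Summing over the
  vertices, the affine part is evaluated by the handshake lemma, and the remainders are collected
  by degree.  Taking for \<open>t\<close> the slope of \<open>f\<close> over \<open>[\<delta>, \<Delta>]\<close> or over \<open>[\<delta>, \<delta> + 1]\<close> makes the remainder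
  vanish at the two end points, and its sign at other degrees is given by the convexity or
  concavity of \<open>f = (\<lambda>x. x powr \<alpha>)\<close>.  The coindex reduces to the index: every vertex \<open>u\<close> lies in
  \<open>n - 1 - d(u)\<close> non-edges, so the coindex is \<open>(n - 1)\<close> times the index for \<open>\<alpha>\<close> minus the index for
  \<open>\<alpha> + 1\<close>.\<close>

section \<open>Double counting of incidences between vertices and edges\<close>

lemma finite_vertex_pairs:
  assumes "finite V"
  shows "finite (vertex_pairs V)"
proof (rule finite_subset)
  show "vertex_pairs V \<subseteq> Pow V" by (auto simp: vertex_pairs_def)
qed (use assms in simp)

lemma deg_vertex_pairs:
  assumes "u \<in> V"
  shows "deg (vertex_pairs V) u = card V - 1"
proof -
  have "{e \<in> vertex_pairs V. u \<in> e} = (\<lambda>v. {u, v}) ` (V - {u})"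
    using assms by (auto simp: vertex_pairs_def)
  moreover have "inj_on (\<lambda>v. {u, v}) (V - {u})"
    by (auto simp: inj_on_def doubleton_eq_iff)
  ultimately show ?thesis
    using assms by (simp add: deg_def card_image)
qed

text \<open>Swapping the two sums counts \<open>g u\<close> once for every pair in \<open>F\<close>
  containing \<open>u\<close>. Leaving \<open>F\<close> open covers both the graph itself and the
  complete graph \<open>vertex_pairs V\<close>.\<close>

lemma sum_incidence:
  fixes g :: "'a \<Rightarrow> real"
  assumes "finite V" and sub: "F \<subseteq> vertex_pairs V"
  shows "(\<Sum>e\<in>F. \<Sum>w\<in>e. g w) = (\<Sum>u\<in>V. real (deg F u) * g u)"
proof -
  have "finite F"
    using finite_subset[OF sub] finite_vertex_pairs assms(1) by blast
  have "(\<Sum>e\<in>F. \<Sum>w\<in>e. g w) = (\<Sum>e\<in>F. \<Sum>w\<in>{w\<in>V. w \<in> e}. g w)"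
    using sub by (intro sum.cong refl) (auto simp: vertex_pairs_def)
  also have "\<dots> = (\<Sum>u\<in>V. \<Sum>e\<in>{e\<in>F. u \<in> e}. g u)"
    by (rule sum.swap_restrict) fact+
  finally show ?thesis by (simp add: deg_def)
qed

text \<open>The handshake lemma: incidence counting with constant weight 1, each edge having exactly
  two elements.\<close>

lemma sum_deg:
  assumes "finite_simple_graph V E"
  shows "(\<Sum>u\<in>V. real (deg E u)) = 2 * real (card E)"
proof -
  have "(\<Sum>e\<in>E. \<Sum>w\<in>e. 1::real) = (\<Sum>e\<in>E. 2)"
    using assms by (intro sum.cong) (auto simp: finite_simple_graph_def vertex_pairs_def)
  moreover have "(\<Sum>e\<in>E. \<Sum>w\<in>e. 1::real) = (\<Sum>u\<in>V. real (deg E u) * 1)"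
    using assms unfolding finite_simple_graph_def by (intro sum_incidence) auto
  ultimately show ?thesis by simp
qed

text \<open>Non-edges are treated as all pairs minus edges. The weights remain powers of degrees in
  \<open>E\<close> in both sums, so the complement graph is never formed.\<close>

lemma zagreb_co_eq:
  assumes "finite_simple_graph V E"
  shows "zagreb_co \<alpha> V E = (real (card V) - 1) * zagreb \<alpha> V E - zagreb (\<alpha> + 1) V E"
proof -
  have V: "finite V" and E: "E \<subseteq> vertex_pairs V"
    using assms by (auto simp: finite_simple_graph_def)
  let ?g = "\<lambda>u. real (deg E u) powr \<alpha>"
  have "zagreb_co \<alpha> V E
      = (\<Sum>e\<in>vertex_pairs V. \<Sum>w\<in>e. ?g w) - (\<Sum>e\<in>E. \<Sum>w\<in>e. ?g w)"
    unfolding zagreb_co_def by (rule sum_diff[OF finite_vertex_pairs[OF V] E])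
  also have "\<dots> = (\<Sum>u\<in>V. real (deg (vertex_pairs V) u) * ?g u) - (\<Sum>u\<in>V. real (deg E u) * ?g u)"
    by (simp only: sum_incidence[OF V subset_refl] sum_incidence[OF V E])
  also have "(\<Sum>u\<in>V. real (deg (vertex_pairs V) u) * ?g u) = (\<Sum>u\<in>V. (real (card V) - 1) * ?g u)"
  proof (intro sum.cong refl)
    fix u assume u: "u \<in> V"
    \<comment> \<open>Nonemptiness makes the truncated \<open>card V - 1\<close> agree with the real
      difference.\<close>
    then have "card V > 0" using V by (auto simp: card_gt_0_iff)
    then show "real (deg (vertex_pairs V) u) * ?g u = (real (card V) - 1) * ?g u"
      by (simp add: deg_vertex_pairs[OF u] of_nat_diff)
  qed
  \<comment> \<open>The factor contributed by incidence raises the exponent by one; this also holds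
    at degree 0, where both sides are 0.\<close>
  also have "(\<Sum>u\<in>V. real (deg E u) * ?g u) = zagreb (\<alpha> + 1) V E"
    by (simp add: zagreb_def powr_mult_base add.commute)
  finally show ?thesis by (simp add: zagreb_def sum_distrib_left)
qed

section \<open>Grouping vertices by degree\<close>

lemma min_deg_le: "finite V \<Longrightarrow> u \<in> V \<Longrightarrow> min_deg V E \<le> deg E u"
  by (simp add: min_deg_def)

lemma max_deg_ge: "finite V \<Longrightarrow> u \<in> V \<Longrightarrow> deg E u \<le> max_deg V E"
  by (simp add: max_deg_def)

lemma sum_by_degree:
  fixes g :: "nat \<Rightarrow> real" and V :: "'a set" and E :: "'a set set"
  assumes "finite V"
  defines "\<delta> \<equiv> min_deg V E" and "\<Delta> \<equiv> max_deg V E"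
  shows "(\<Sum>u\<in>V. g (deg E u - \<delta>)) = (\<Sum>i = 0..\<Delta> - \<delta>. real (num_deg V E (\<delta> + i)) * g i)"
proof -
  have "(\<Sum>u\<in>V. g (deg E u - \<delta>))
      = (\<Sum>i = 0..\<Delta> - \<delta>. \<Sum>u\<in>{u\<in>V. deg E u - \<delta> = i}. g (deg E u - \<delta>))"
    using assms max_deg_ge[OF assms(1)]
    by (intro sum.group[symmetric]) (auto intro!: diff_le_mono)
  also have "\<dots> = (\<Sum>i = 0..\<Delta> - \<delta>. real (num_deg V E (\<delta> + i)) * g i)"
  proof (intro sum.cong refl)
    fix i
    \<comment> \<open>No degree lies below \<delta>, so truncated subtraction does not merge smaller
      degrees into the class \<open>i = 0\<close>.\<close>
    have "{u \<in> V. deg E u - \<delta> = i} = {u \<in> V. deg E u = \<delta> + i}"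
      using min_deg_le[OF assms(1), of _ E] unfolding \<delta>_def by fastforce
    then show "(\<Sum>u\<in>{u\<in>V. deg E u - \<delta> = i}. g (deg E u - \<delta>)) = real (num_deg V E (\<delta> + i)) * g i"
      by (simp add: num_deg_def)
  qed
  finally show ?thesis .
qed

text \<open>With \<open>t\<close> and \<open>I\<close> left open, one identity yields both
  expansions: \<open>I\<close> omits only degrees at which the line of slope \<open>t\<close>
  through the point at \<delta> meets the power function.\<close>

lemma zagreb_expansion:
  assumes "finite_simple_graph V E"
  defines "\<delta> \<equiv> min_deg V E" and "\<Delta> \<equiv> max_deg V E" and "n \<equiv> card V" and "m \<equiv> card E"
  assumes I: "I \<subseteq> {0..\<Delta> - \<delta>}"
    and zero: "\<And>i. i \<in> {0..\<Delta> - \<delta>} - I \<Longrightarrow> real (\<delta> + i) powr \<alpha> - real \<delta> powr \<alpha> - real i * t = 0"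
  shows "zagreb \<alpha> V E = real n * real \<delta> powr \<alpha> + (2 * real m - real n * real \<delta>) * t
    + (\<Sum>i\<in>I. real (num_deg V E (\<delta> + i)) * (real (\<delta> + i) powr \<alpha> - real \<delta> powr \<alpha> - real i * t))"
proof -
  have V: "finite V" using assms by (simp add: finite_simple_graph_def)
  let ?r = "\<lambda>i. real (\<delta> + i) powr \<alpha> - real \<delta> powr \<alpha> - real i * t"
  have "zagreb \<alpha> V E
      = (\<Sum>u\<in>V. real \<delta> powr \<alpha> + (real (deg E u) - real \<delta>) * t + ?r (deg E u - \<delta>))"
    unfolding zagreb_def
    using min_deg_le[OF V, of _ E] by (intro sum.cong refl) (simp add: \<delta>_def of_nat_diff)
  also have "\<dots> = real n * real \<delta> powr \<alpha> + ((\<Sum>u\<in>V. real (deg E u)) - real n * real \<delta>) * t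
      + (\<Sum>u\<in>V. ?r (deg E u - \<delta>))"
    by (simp only: sum.distrib sum_subtractf flip: sum_distrib_right) (simp add: n_def)
  also have "(\<Sum>u\<in>V. ?r (deg E u - \<delta>)) = (\<Sum>i = 0..\<Delta> - \<delta>. real (num_deg V E (\<delta> + i)) * ?r i)"
    unfolding \<delta>_def \<Delta>_def by (rule sum_by_degree[OF V])
  also have "\<dots> = (\<Sum>i\<in>I. real (num_deg V E (\<delta> + i)) * ?r i)"
    using I zero by (intro sum.mono_neutral_right) auto
  finally show ?thesis by (simp only: sum_deg[OF assms(1)] m_def)
qed

section \<open>Convexity and concavity of real powers\<close>

lemma powr_mvt:
  fixes a b p :: real
  assumes "0 \<le> a" "a < b" "p \<le> 0 \<Longrightarrow> 0 < a"
  obtains z where "a < z" "z < b" "b powr p - a powr p = (b - a) * (p * z powr (p - 1))"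
proof -
  \<comment> \<open>The left end may be 0 when \<open>p > 0\<close>: only continuity is needed
    there, while the derivative is taken at interior, hence positive, points.\<close>
  have cont: "continuous_on {a..b} (\<lambda>x. x powr p)"
    using assms by (intro continuous_on_powr') (auto simp flip: not_le)
  have der: "((\<lambda>x. x powr p) has_derivative (*) (p * x powr (p - 1))) (at x)"
    if "a < x" "x < b" for x
  proof -
    have "((\<lambda>x. x powr p) has_field_derivative p * x powr (p - 1)) (at x)"
      using that assms by (intro has_real_derivative_powr) auto
    then show ?thesis by (simp add: has_field_derivative_def)
  qed
  from mvt[OF \<open>a < b\<close> cont der] obtain z where
    "a < z" "z < b" "b powr p - a powr p = p * z powr (p - 1) * (b - a)"
    by blast
  then show thesis by (intro that) (simp_all only: mult_ac)
qed

text \<open>For \<open>p < 1\<close> the power with exponent \<open>p - 1\<close> decreases; a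
  negative factor \<open>p\<close> reverses this, a positive one keeps it. For \<open>p > 1\<close>
  the power increases.\<close>

lemma powr_deriv_mono:
  fixes p y z :: real
  assumes "0 < y" "y \<le> z"
  shows "p < 0 \<or> p > 1 \<Longrightarrow> p * y powr (p - 1) \<le> p * z powr (p - 1)"
    and "0 < p \<Longrightarrow> p < 1 \<Longrightarrow> p * z powr (p - 1) \<le> p * y powr (p - 1)"
proof -
  have dec: "z powr (p - 1) \<le> y powr (p - 1)" if "p < 1"
    using assms that by (intro powr_mono2') auto
  have inc: "y powr (p - 1) \<le> z powr (p - 1)" if "p > 1"
    using assms that by (intro powr_mono2) auto
  show "p < 0 \<or> p > 1 \<Longrightarrow> p * y powr (p - 1) \<le> p * z powr (p - 1)"
    using dec inc by (elim disjE) (simp_all add: mult_left_mono_neg)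
  show "0 < p \<Longrightarrow> p < 1 \<Longrightarrow> p * z powr (p - 1) \<le> p * y powr (p - 1)"
    using dec by (simp add: mult_left_mono)
qed

text \<open>The three-point form of convexity and concavity, cleared of denominators. The mean
  slopes over \<open>[a, c]\<close> and \<open>[c, b]\<close> are derivative values at points
  \<open>y \<le> z\<close>, so monotonicity of the derivative decides the sign, even for
  \<open>a = 0\<close> when \<open>p > 0\<close>.\<close>

lemma powr_chord:
  fixes a b c p :: real
  assumes ac: "0 \<le> a" "a < c" and cb: "c < b" and pos: "p < 0 \<Longrightarrow> 0 < a"
  shows "p < 0 \<or> p > 1 \<Longrightarrow> (b - a) * c powr p \<le> (b - c) * a powr p + (c - a) * b powr p"
    and "0 < p \<Longrightarrow> p < 1 \<Longrightarrow> (b - c) * a powr p + (c - a) * b powr p \<le> (b - a) * c powr p"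
proof -
  have gap: "\<exists>y z. 0 < y \<and> y \<le> z \<and>
      (b - c) * a powr p + (c - a) * b powr p - (b - a) * c powr p
        = (b - c) * (c - a) * (p * z powr (p - 1) - p * y powr (p - 1))" if p: "p \<noteq> 0"
  proof -
    \<comment> \<open>Excluding \<open>p = 0\<close> turns \<open>pos\<close> into the side
      condition of \<open>powr_mvt\<close>.\<close>
    have a: "p \<le> 0 \<Longrightarrow> 0 < a" using p by (intro pos) simp
    obtain y where y: "a < y" "y < c" "c powr p - a powr p = (c - a) * (p * y powr (p - 1))"
      by (rule powr_mvt[of a c p]) (use ac a in simp_all)
    obtain z where z: "c < z" "z < b" "b powr p - c powr p = (b - c) * (p * z powr (p - 1))"
      by (rule powr_mvt[of c b p]) (use ac cb in linarith)+
    have "(b - c) * a powr p + (c - a) * b powr p - (b - a) * c powr p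
        = (c - a) * (b powr p - c powr p) - (b - c) * (c powr p - a powr p)"
      by (simp add: algebra_simps)
    also have "\<dots> = (b - c) * (c - a) * (p * z powr (p - 1) - p * y powr (p - 1))"
      unfolding y(3) z(3) by (simp add: algebra_simps)
    finally show ?thesis
      using y(1,2) z(1) ac by (intro exI[of _ y] exI[of _ z]) linarith
  qed
  have w: "0 \<le> (b - c) * (c - a)" using ac cb by simp
  show "(b - a) * c powr p \<le> (b - c) * a powr p + (c - a) * b powr p" if "p < 0 \<or> p > 1"
  proof -
    from that have "p \<noteq> 0" by auto
    from gap[OF this] obtain y z where yz: "0 < y" "y \<le> z" and
      eq: "(b - c) * a powr p + (c - a) * b powr p - (b - a) * c powr p
        = (b - c) * (c - a) * (p * z powr (p - 1) - p * y powr (p - 1))" by blast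
    have "0 \<le> (b - c) * a powr p + (c - a) * b powr p - (b - a) * c powr p"
      unfolding eq using powr_deriv_mono(1)[OF yz that] by (intro mult_nonneg_nonneg[OF w]) simp
    then show ?thesis by linarith
  qed
  show "(b - c) * a powr p + (c - a) * b powr p \<le> (b - a) * c powr p" if "0 < p" "p < 1"
  proof -
    from that have "p \<noteq> 0" by auto
    from gap[OF this] obtain y z where yz: "0 < y" "y \<le> z" and
      eq: "(b - c) * a powr p + (c - a) * b powr p - (b - a) * c powr p
        = (b - c) * (c - a) * (p * z powr (p - 1) - p * y powr (p - 1))" by blast
    have "(b - c) * a powr p + (c - a) * b powr p - (b - a) * c powr p \<le> 0"
      unfolding eq using powr_deriv_mono(2)[OF yz that] by (intro mult_nonneg_nonpos[OF w]) simp
    then show ?thesis by linarith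
  qed
qed

lemma chord_remainder:
  fixes a b i :: nat
  assumes "i \<in> {1..b - a - 1}" "p < 0 \<Longrightarrow> 1 \<le> a"
  defines "r \<equiv> real (a + i) powr p - real a powr p - real i * chord_slope a b p"
  shows "p < 0 \<or> p > 1 \<Longrightarrow> r \<le> 0" and "0 < p \<Longrightarrow> p < 1 \<Longrightarrow> 0 \<le> r"
proof -
  \<comment> \<open>If \<open>b \<le> a + 1\<close>, truncated subtraction makes the index range
    empty, so membership of \<open>i\<close> forces \<open>a < a + i < b\<close>.\<close>
  have i: "real a < real (a + i)" "real (a + i) < real b" "real b - real a > 0"
    using assms(1) by auto
  \<comment> \<open>Up to the positive factor \<open>b - a\<close>, \<open>r\<close> is the height
    of the power function above its chord over \<open>[a, b]\<close> at
    \<open>a + i\<close>.\<close>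
  have r: "(real b - real a) * r = (real b - real a) * real (a + i) powr p
      - ((real b - real (a + i)) * real a powr p + (real (a + i) - real a) * real b powr p)"
    using i(3) unfolding r_def chord_slope_def by (simp add: field_simps)
  {
    assume "p < 0 \<or> p > 1"
    then have "(real b - real a) * r \<le> 0"
      using powr_chord(1)[of "real a" "real (a + i)" "real b" p] i assms(2) unfolding r by auto
    with i(3) show "r \<le> 0" by (simp add: mult_le_0_iff)
  next
    assume "0 < p" "p < 1"
    then have "0 \<le> (real b - real a) * r"
      using powr_chord(2)[of "real a" "real (a + i)" "real b" p] i assms(2) unfolding r by auto
    with i(3) show "0 \<le> r" by (simp add: zero_le_mult_iff)
  }
qed

text \<open>The signs are opposite to those for the chord because \<open>a + i\<close> lies beyond
  the interval \<open>[a, a + 1]\<close> that fixes the slope: in \<open>powr_chord\<close> the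
  middle point is now \<open>a + 1\<close>, and \<open>2 \<le> i\<close> keeps it strictly
  inside.\<close>

lemma unit_slope_remainder:
  fixes a i :: nat
  assumes "2 \<le> i" "p < 0 \<Longrightarrow> 1 \<le> a"
  defines "r \<equiv> real (a + i) powr p - real a powr p - real i * ((real a + 1) powr p - real a powr p)"
  shows "p < 0 \<or> p > 1 \<Longrightarrow> 0 \<le> r" and "0 < p \<Longrightarrow> p < 1 \<Longrightarrow> r \<le> 0"
proof -
  have r: "r = (real (a + i) - (real a + 1)) * real a powr p
      + ((real a + 1) - real a) * real (a + i) powr p - (real (a + i) - real a) * (real a + 1) powr p"
    unfolding r_def by (simp add: algebra_simps)
  show "p < 0 \<or> p > 1 \<Longrightarrow> 0 \<le> r"
    using powr_chord(1)[of "real a" "real a + 1" "real (a + i)" p] assms(1,2) unfolding r by auto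
  show "0 < p \<Longrightarrow> p < 1 \<Longrightarrow> r \<le> 0"
    using powr_chord(2)[of "real a" "real a + 1" "real (a + i)" p] assms(1,2) unfolding r by auto
qed

theorem theorem3p2:
  fixes V :: "'a set" and E :: "'a set set"
    and n m \<delta> \<Delta> :: nat and nn :: "nat \<Rightarrow> nat"
    and \<alpha> :: real and s :: "real \<Rightarrow> real"
  assumes graph: "finite_simple_graph V E"
    and n: "n = card V" and n_ge: "n \<ge> 3" and m: "m = card E"
    and nn: "nn = num_deg V E"
    and \<delta>: "\<delta> = min_deg V E" and \<Delta>: "\<Delta> = max_deg V E" and neq: "\<delta> \<noteq> \<Delta>"
    and \<alpha>: "\<alpha> \<notin> {0, 1}" and pos: "\<alpha> < 0 \<Longrightarrow> \<delta> \<ge> 1"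
    and s: "s = chord_slope \<delta> \<Delta>"
  shows
    "((zagreb \<alpha> V E =
           real n * real \<delta> powr \<alpha> + (2 * real m - real n * real \<delta>) * s \<alpha>
           + (\<Sum>i = 1..\<Delta> - \<delta> - 1. real (nn (\<delta> + i)) * (real (\<delta> + i) powr \<alpha> - real \<delta> powr \<alpha> - real i * s \<alpha>)))
       \<and> (\<alpha> < 0 \<or> \<alpha> > 1 \<longrightarrow>
           (\<forall>i\<in>{1..\<Delta> - \<delta> - 1}. (real (\<delta> + i) powr \<alpha> - real \<delta> powr \<alpha> - real i * s \<alpha>) \<le> 0))
       \<and> (0 < \<alpha> \<and> \<alpha> < 1 \<longrightarrow>
           (\<forall>i\<in>{1..\<Delta> - \<delta> - 1}. (real (\<delta> + i) powr \<alpha> - real \<delta> powr \<alpha> - real i * s \<alpha>) \<ge> 0)))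
     \<and>
     ((zagreb \<alpha> V E =
           real n * real \<delta> powr \<alpha> + (2 * real m - real n * real \<delta>) * ((real \<delta> + 1) powr \<alpha> - real \<delta> powr \<alpha>)
           + (\<Sum>i = 2..\<Delta> - \<delta>. real (nn (\<delta> + i)) * (real (\<delta> + i) powr \<alpha> - real \<delta> powr \<alpha> - real i * ((real \<delta> + 1) powr \<alpha> - real \<delta> powr \<alpha>))))
       \<and> (\<alpha> < 0 \<or> \<alpha> > 1 \<longrightarrow>
           (\<forall>i\<in>{2..\<Delta> - \<delta>}. (real (\<delta> + i) powr \<alpha> - real \<delta> powr \<alpha> - real i * ((real \<delta> + 1) powr \<alpha> - real \<delta> powr \<alpha>)) \<ge> 0))
       \<and> (0 < \<alpha> \<and> \<alpha> < 1 \<longrightarrow>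
           (\<forall>i\<in>{2..\<Delta> - \<delta>}. (real (\<delta> + i) powr \<alpha> - real \<delta> powr \<alpha> - real i * ((real \<delta> + 1) powr \<alpha> - real \<delta> powr \<alpha>)) \<le> 0)))
     \<and>
     (\<alpha> > 1 \<longrightarrow> zagreb_co \<alpha> V E =
           real n * (real n - 1) * real \<delta> powr \<alpha> + (2 * real m - real n * real \<delta>) * s \<alpha> * (real n - 1)
           + (real n - 1) * (\<Sum>i = 1..\<Delta> - \<delta> - 1. real (nn (\<delta> + i)) * (real (\<delta> + i) powr \<alpha> - real \<delta> powr \<alpha> - real i * s \<alpha>))
           - real n * real \<delta> powr (\<alpha> + 1) - (2 * real m - real n * real \<delta>) * s (\<alpha> + 1)
           - (\<Sum>i = 1..\<Delta> - \<delta> - 1. real (nn (\<delta> + i)) * (real (\<delta> + i) powr (\<alpha> + 1) - real \<delta> powr (\<alpha> + 1) - real i * s (\<alpha> + 1))))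
     \<and>
     (\<alpha> > 1 \<longrightarrow> zagreb_co \<alpha> V E =
           real n * (real n - 1) * real \<delta> powr \<alpha> + (2 * real m - real n * real \<delta>) * ((real \<delta> + 1) powr \<alpha> - real \<delta> powr \<alpha>) * (real n - 1)
           + (real n - 1) * (\<Sum>i = 2..\<Delta> - \<delta>. real (nn (\<delta> + i)) * (real (\<delta> + i) powr \<alpha> - real \<delta> powr \<alpha> - real i * ((real \<delta> + 1) powr \<alpha> - real \<delta> powr \<alpha>)))
           - real n * real \<delta> powr (\<alpha> + 1) - (2 * real m - real n * real \<delta>) * ((real \<delta> + 1) powr (\<alpha> + 1) - real \<delta> powr (\<alpha> + 1))
           - (\<Sum>i = 2..\<Delta> - \<delta>. real (nn (\<delta> + i)) * (real (\<delta> + i) powr (\<alpha> + 1) - real \<delta> powr (\<alpha> + 1) - real i * ((real \<delta> + 1) powr (\<alpha> + 1) - real \<delta> powr (\<alpha> + 1)))))"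
proof -
  have V: "finite V" using graph by (simp add: finite_simple_graph_def)
  \<comment> \<open>One vertex suffices to compare \<delta> with \<Delta> and sharpen
    \<open>neq\<close> to a strict inequality.\<close>
  have "V \<noteq> {}" using n n_ge by auto
  then obtain u where "u \<in> V" by blast
  then have less: "\<delta> < \<Delta>"
    using min_deg_le[OF V, of u E] max_deg_ge[OF V, of u E] neq unfolding \<delta> \<Delta> by linarith
  \<comment> \<open>The exponent stays arbitrary because the coindex formulas use both \<alpha> and
    \<open>\<alpha> + 1\<close>.\<close>
  have chord: "zagreb p V E =
      real n * real \<delta> powr p + (2 * real m - real n * real \<delta>) * s p
      + (\<Sum>i = 1..\<Delta> - \<delta> - 1. real (nn (\<delta> + i)) * (real (\<delta> + i) powr p - real \<delta> powr p - real i * s p))"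
    for p
    unfolding n m nn \<delta> \<Delta>
  proof (rule zagreb_expansion[OF graph], goal_cases)
    case 1
    show ?case by auto
  next
    case (2 i)
    \<comment> \<open>The omitted indices are the two ends of the chord.\<close>
    then have "i = 0 \<or> i = \<Delta> - \<delta>" unfolding \<delta> \<Delta> by auto
    then show ?case
      using less by (auto simp: s chord_slope_def of_nat_diff simp flip: \<delta> \<Delta>)
  qed
  have unit: "zagreb p V E =
      real n * real \<delta> powr p + (2 * real m - real n * real \<delta>) * ((real \<delta> + 1) powr p - real \<delta> powr p)
      + (\<Sum>i = 2..\<Delta> - \<delta>. real (nn (\<delta> + i)) * (real (\<delta> + i) powr p - real \<delta> powr p - real i * ((real \<delta> + 1) powr p - real \<delta> powr p)))"
    for p
    unfolding n m nn \<delta> \<Delta>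
  proof (rule zagreb_expansion[OF graph], goal_cases)
    case 1
    show ?case by auto
  next
    case (2 i)
    \<comment> \<open>Here the line interpolates at \<delta> and \<open>\<delta> + 1\<close>, so
      these indices drop out.\<close>
    then have "i = 0 \<or> i = 1" by auto
    then show ?case by (auto simp: add.commute)
  qed
  have coindex: "zagreb_co \<alpha> V E = (real n - 1) * zagreb \<alpha> V E - zagreb (\<alpha> + 1) V E"
    unfolding n by (rule zagreb_co_eq[OF graph])
  \<comment> \<open>The common algebra of both coindex formulas, with each sum over degrees treated
    as a single real \<open>S\<close> or \<open>S'\<close>.\<close>
  have arith: "(N - 1) * (N * P + M * t + S) - (N * P' + M * t' + S')
      = N * (N - 1) * P + M * t * (N - 1) + (N - 1) * S - N * P' - M * t' - S'"
    for N P M t S P' t' S' :: real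
    by (simp add: algebra_simps)
  show ?thesis
  proof (intro conjI impI ballI, goal_cases)
    case 1
    show ?case by (rule chord)
  next
    case (2 i)
    then show ?case using pos unfolding s by (intro chord_remainder(1)) auto
  next
    case (3 i)
    then show ?case using pos unfolding s by (intro chord_remainder(2)) auto
  next
    case 4
    show ?case by (rule unit)
  next
    case (5 i)
    then show ?case using pos by (intro unit_slope_remainder(1)) auto
  next
    case (6 i)
    then show ?case using pos by (intro unit_slope_remainder(2)) auto
  next
    case 7
    show ?case unfolding coindex chord by (rule arith)
  next
    case 8
    show ?case unfolding coindex unit by (rule arith)
  qed
qed

end
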